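(* Let $p\in(1,\infty)$. There exists a constant $c=c(p)>0$, depending only on $p$, such that for every bounded interval $I_0\subset\mathbb{R}$ of positive length and every monotone function $f:I_0\to\mathbb{R}$ with $f\in L^1(I_0)$, $$\|f\|_{JN_p(I_0)}\ \ge\ c\,\|f-\langle f\rangle_{I_0}\|_{L^p(I_0)}$$ (where both sides may take the value $+\infty$).
   Context: For an interval $J$ of positive finite length, $\langle f\rangle_J=\frac1{|J|}\int_J f$. For $f\in L^1(I_0)$, $$\|f\|_{JN_p(I_0)}^p:=\sup\sum_i |J_i|\Big(\frac1{|J_i|}\int_{J_i}|f-\langle f\rangle_{J_i}|\Big)^p\in[0,\infty],$$ where the supremum is over all collections of pairwise disjoint subintervals $J_i\subset I_0$ of positive length. *)

theory Defs
  imports "HOL-Analysis.Analysis"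
begin

(* Functions on an interval are total functions whose values outside it are ignored.
   Intervals are sets satisfying is_interval, so each endpoint may or may not belong
   to the interval. *)

definition average :: "(real \<Rightarrow> real) \<Rightarrow> real set \<Rightarrow> real" where
  "average f J = (1 / measure lebesgue J) * (LINT x:J|lebesgue. f x)"

definition mean_osc :: "(real \<Rightarrow> real) \<Rightarrow> real set \<Rightarrow> real" where
  "mean_osc f J = average (\<lambda>x. \<bar>f x - average f J\<bar>) J"

(* Intended for exponents a > 0. *)
definition ennreal_powr :: "ennreal \<Rightarrow> real \<Rightarrow> ennreal" where
  "ennreal_powr x a = (if x = \<infinity> then \<infinity> else ennreal (enn2real x powr a))"

(* The families may be finite or infinite; an infinite one is automatically countable,
   since its members are disjoint and of positive length. *)
definition subinterval_families :: "real set \<Rightarrow> real set set set" where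
  "subinterval_families I =
     {F. disjoint F \<and> (\<forall>J\<in>F. is_interval J \<and> J \<subseteq> I \<and> 0 < measure lebesgue J)}"

definition JN_norm :: "real \<Rightarrow> real set \<Rightarrow> (real \<Rightarrow> real) \<Rightarrow> ennreal" where
  "JN_norm p I f =
     ennreal_powr
       (SUP F\<in>subinterval_families I.
          \<Sum>\<^sub>\<infinity>J\<in>F. ennreal (measure lebesgue J * mean_osc f J powr p))
       (1 / p)"

definition Lp_norm :: "real \<Rightarrow> real set \<Rightarrow> (real \<Rightarrow> real) \<Rightarrow> ennreal" where
  "Lp_norm p I f =
     ennreal_powr (\<integral>\<^sup>+x\<in>I. ennreal (\<bar>f x\<bar> powr p) \<partial>lebesgue) (1 / p)"

end

theory Submission
  imports Defs
begin

text \<open>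
  Compare the deviation of \<open>f\<close> from its value at the midpoint \<open>m\<close> of the interval, on one half
  at a time. Let \<open>e\<close> be the end of that half that is an end of the interval, \<open>h\<close> the signed
  length from \<open>e\<close> to the other end, and \<open>y\<^sub>k = e + h / 2^k\<close>, so that \<open>y\<^sub>1 = m\<close>. Between
  \<open>y\<^sub>k\<^sub>+\<^sub>2\<close> and \<open>y\<^sub>k\<^sub>+\<^sub>1\<close>, monotonicity bounds \<open>\<bar>f - f m\<bar>\<close> by
  \<open>D\<^sub>k = \<bar>f y\<^sub>k\<^sub>+\<^sub>2 - f m\<bar>\<close>, and \<open>D\<^sub>k\<close> is at most the sum of the jumps
  \<open>d\<^sub>j = \<bar>f y\<^sub>j\<^sub>+\<^sub>1 - f y\<^sub>j\<^sub>+\<^sub>2\<bar>\<close> with \<open>j \<le> k\<close>.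

  Since the lengths decrease geometrically, a dyadic Hardy inequality (\<open>dyadic_Hardy\<close>) gives
  \<open>\<Sum> 2^-k D\<^sub>k^p \<le> C \<Sum> 2^-k d\<^sub>k^p\<close>. In turn \<open>d\<^sub>k\<close> is at most a constant times the mean
  oscillation of \<open>f\<close> on the larger interval between \<open>y\<^sub>k\<close> and \<open>y\<^sub>k\<^sub>+\<^sub>3\<close>
  (\<open>jump_le_mean_osc\<close>): a monotone function that jumps by \<open>d\<close> between two points and has room on
  either side of them is at distance at least \<open>d / 2\<close> from any constant on one of the two sides.
  These larger intervals overlap, but those with the same residue of \<open>k\<close> modulo 3 are disjoint, so
  the sum over all of them is at most three times the supremum in the JN norm
  (\<open>sum_dyadic_cells_le\<close>).

  To pass from \<open>f m\<close> to the average of \<open>f\<close>, observe that for any constant \<open>c\<close>, throughout one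
  of the halves \<open>f\<close> is at least as far from \<open>c\<close> as \<open>f m\<close> is; so \<open>\<bar>f m - c\<bar>\<close>, with \<open>c\<close> the
  average, is controlled by the mean oscillation on the whole interval, which is itself a term
  admitted in the JN norm.
\<close>

section \<open>The JN supremum and lower bounds for mean oscillation\<close>

definition JN_energy :: "real \<Rightarrow> real set \<Rightarrow> (real \<Rightarrow> real) \<Rightarrow> ennreal" where
  "JN_energy p I f = (SUP F\<in>subinterval_families I.
     \<Sum>\<^sub>\<infinity>J\<in>F. ennreal (measure lebesgue J * mean_osc f J powr p))"

text \<open>
  This lets the main estimate be proved for \<open>p\<close>-th powers and the root be taken once, at the end,
  with infinite values included.
\<close>
lemma ennreal_powr_scaled_le:
  assumes "X \<le> ennreal C * S" "0 < C" "0 < a"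
  shows "ennreal (C powr - a) * ennreal_powr X a \<le> ennreal_powr S a"
proof (cases "S = \<infinity>")
  case True
  then show ?thesis by (simp add: ennreal_powr_def)
next
  case False
  then obtain s where s: "S = ennreal s" "0 \<le> s" by (cases S) auto
  have X: "X \<le> ennreal (C * s)" using assms s by (simp add: ennreal_mult)
  then obtain x where x: "X = ennreal x" "0 \<le> x"
    by (cases X) (auto simp: top_unique)
  have "x \<le> C * s" using X x s assms by simp
  then have "x powr a \<le> (C * s) powr a" using x assms by (intro powr_mono2) auto
  also have "\<dots> = C powr a * s powr a" using s assms by (simp add: powr_mult)
  finally have "C powr - a * x powr a \<le> s powr a"
    using assms by (simp add: powr_minus field_simps)
  then show ?thesis
    using x s by (simp add: ennreal_powr_def flip: ennreal_mult')
qed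

lemma sum_le_JN_energy:
  fixes K :: "'i \<Rightarrow> real set"
  assumes "finite T" "disjoint_family_on K T"
    and K: "\<And>j. j \<in> T \<Longrightarrow> is_interval (K j) \<and> K j \<subseteq> I \<and> 0 < measure lebesgue (K j)"
  shows "(\<Sum>j\<in>T. ennreal (measure lebesgue (K j) * mean_osc f (K j) powr p)) \<le> JN_energy p I f"
proof -
  have ne: "K j \<noteq> {}" if "j \<in> T" for j using K[OF that] by auto
  have inj: "inj_on K T"
    using assms(2) ne unfolding inj_on_def disjoint_family_on_def by (metis Int_absorb)
  have "disjoint (K ` T)"
    using assms(2) by (rule disjoint_family_on_disjoint_image)
  then have F: "K ` T \<in> subinterval_families I"
    using K by (auto simp: subinterval_families_def)
  have "(\<Sum>j\<in>T. ennreal (measure lebesgue (K j) * mean_osc f (K j) powr p))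
      = (\<Sum>\<^sub>\<infinity>J\<in>K ` T. ennreal (measure lebesgue J * mean_osc f J powr p))"
    using assms(1) inj by (simp add: sum.reindex)
  also have "\<dots> \<le> JN_energy p I f"
    unfolding JN_energy_def by (rule SUP_upper[OF F])
  finally show ?thesis .
qed

text \<open>
  The only way in which mean oscillations are bounded from below here: it suffices that \<open>f\<close> stays
  away from its average on some part of the interval.
\<close>
lemma mean_osc_ge:
  assumes "set_integrable lebesgue J f" "J \<in> fmeasurable lebesgue" "0 < measure lebesgue J"
    and A: "A \<in> sets lebesgue" "A \<subseteq> J"
    and r: "\<And>x. x \<in> A \<Longrightarrow> r \<le> \<bar>f x - average f J\<bar>"
  shows "r * measure lebesgue A \<le> measure lebesgue J * mean_osc f J"
proof -
  have fA: "A \<in> fmeasurable lebesgue" using assms fmeasurableI2 by blast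
  have "set_integrable lebesgue J (\<lambda>x. average f J)"
    using assms(2) unfolding set_integrable_def fmeasurable_def
    by (intro integrable_scaleR_left integrable_real_indicator) auto
  then have "set_integrable lebesgue J (\<lambda>x. \<bar>f x - average f J\<bar>)"
    using assms(1) by (intro set_integrable_abs set_integral_diff)
  moreover have "integrable lebesgue (\<lambda>x. indicator A x *\<^sub>R r)"
    using fA unfolding fmeasurable_def
    by (intro integrable_scaleR_left integrable_real_indicator) auto
  ultimately have "(LINT x|lebesgue. indicator A x *\<^sub>R r)
      \<le> (LINT x:J|lebesgue. \<bar>f x - average f J\<bar>)"
    unfolding set_lebesgue_integral_def set_integrable_def
    using r A by (intro integral_mono) (auto simp: indicator_def)
  then show ?thesis using assms(3)
    by (simp add: mean_osc_def average_def[of "\<lambda>x. \<bar>f x - average f J\<bar>"] mult.commute)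
qed

lemma mean_osc_nonneg: "0 \<le> mean_osc f J"
  unfolding mean_osc_def average_def set_lebesgue_integral_def
  by (intro mult_nonneg_nonneg integral_nonneg_AE) auto

section \<open>A dyadic Hardy inequality\<close>

text \<open>
  Whichever of \<open>\<epsilon> * x\<close> and \<open>y\<close> is larger absorbs the other. The coefficient of the first term
  is as close to 1 as desired, at the price of the second.
\<close>
lemma powr_add_le:
  fixes x y p \<epsilon> :: real
  assumes "0 \<le> x" "0 \<le> y" "0 < p" "0 < \<epsilon>"
  shows "(x + y) powr p \<le> (1 + \<epsilon>) powr p * x powr p + (1 + 1 / \<epsilon>) powr p * y powr p"
proof (cases "y \<le> \<epsilon> * x")
  case True
  then have "(x + y) powr p \<le> ((1 + \<epsilon>) * x) powr p"
    using assms by (intro powr_mono2) (auto simp: algebra_simps)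
  also have "\<dots> = (1 + \<epsilon>) powr p * x powr p"
    using assms by (simp add: powr_mult)
  finally show ?thesis by (simp add: add_increasing2)
next
  case False
  then have "(x + y) powr p \<le> ((1 + 1 / \<epsilon>) * y) powr p"
    using assms by (intro powr_mono2) (auto simp: field_simps)
  also have "\<dots> = (1 + 1 / \<epsilon>) powr p * y powr p"
    using assms by (simp add: powr_mult)
  finally show ?thesis by (simp add: add_increasing)
qed

text \<open>
  With \<open>\<epsilon> = (3/2) powr (1/p) - 1\<close>, the coefficient of \<open>x powr p\<close> in the preceding lemma is
  \<open>3/2\<close>; the factor 4 sums the geometric series of ratio \<open>3/4 = 3/2 * 1/2\<close>.
\<close>
definition Hardy_const :: "real \<Rightarrow> real" where
  "Hardy_const p = 4 * (1 + 1 / ((3/2) powr (1 / p) - 1)) powr p"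

lemma Hardy_const_ge: "0 < p \<Longrightarrow> 4 \<le> Hardy_const p"
  unfolding Hardy_const_def by (simp add: ge_one_powr_ge_zero)

text \<open>
  Passing from \<open>k\<close> to \<open>k + 1\<close> multiplies \<open>D k powr p\<close> by at most \<open>3/2\<close>, up to a multiple of
  \<open>d (k + 1) powr p\<close>, while the weight is halved. The weighted sum of the \<open>D k powr p\<close> is therefore
  at most \<open>3/4\<close> of itself plus the sum of the \<open>d k powr p\<close>, and the former part can be absorbed.
  Finite sums are used so that the absorbed quantity is finite.
\<close>
lemma dyadic_Hardy:
  fixes p :: real and D d :: "nat \<Rightarrow> real"
  assumes "0 < p" and D: "\<And>k. 0 \<le> D k" and d: "\<And>k. 0 \<le> d k" and D0: "D 0 \<le> d 0"
    and step: "\<And>k. D (Suc k) \<le> D k + d (Suc k)"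
  shows "(\<Sum>k<N. (1/2) ^ k * D k powr p) \<le> Hardy_const p * (\<Sum>k<N. (1/2) ^ k * d k powr p)"
proof -
  define \<epsilon> where "\<epsilon> = (3/2) powr (1 / p) - (1::real)"
  have \<epsilon>: "0 < \<epsilon>" using assms by (simp add: \<epsilon>_def)
  have \<epsilon>p: "(1 + \<epsilon>) powr p = 3/2" using assms by (simp add: \<epsilon>_def powr_powr)
  define M where "M = (1 + 1 / \<epsilon>) powr p"
  have M: "1 \<le> M" unfolding M_def using \<epsilon> assms by (intro ge_one_powr_ge_zero) auto
  define S where "S N = (\<Sum>k<N. (1/2) ^ k * D k powr p)" for N
  define T where "T N = (\<Sum>k<N. (1/2) ^ k * d k powr p)" for N
  have step': "(1/2) ^ Suc k * D (Suc k) powr p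
      \<le> 3/4 * ((1/2) ^ k * D k powr p) + M * ((1/2) ^ Suc k * d (Suc k) powr p)" for k
  proof -
    have "D (Suc k) powr p \<le> (D k + d (Suc k)) powr p"
      using D step assms by (intro powr_mono2) auto
    also have "\<dots> \<le> 3/2 * D k powr p + M * d (Suc k) powr p"
      using powr_add_le[OF D[of k] d[of "Suc k"] assms(1) \<epsilon>] by (simp add: \<epsilon>p M_def)
    finally have "(1/2) ^ Suc k * D (Suc k) powr p
        \<le> (1/2) ^ Suc k * (3/2 * D k powr p + M * d (Suc k) powr p)"
      by (intro mult_left_mono) auto
    then show ?thesis by (simp add: algebra_simps)
  qed
  have zero: "D 0 powr p \<le> M * d 0 powr p"
  proof -
    have "D 0 powr p \<le> 1 * d 0 powr p" using D D0 assms by (simp add: powr_mono2)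
    also have "\<dots> \<le> M * d 0 powr p" using M by (intro mult_right_mono) auto
    finally show ?thesis .
  qed
  have rec: "S (Suc N) \<le> 3/4 * S N + M * T (Suc N)" for N
  proof (induction N)
    case 0
    then show ?case using zero by (simp add: S_def T_def)
  next
    case (Suc N)
    have "S (Suc (Suc N)) = S (Suc N) + (1/2) ^ Suc N * D (Suc N) powr p"
      and "S (Suc N) = S N + (1/2) ^ N * D N powr p"
      and "T (Suc (Suc N)) = T (Suc N) + (1/2) ^ Suc N * d (Suc N) powr p"
      by (simp_all add: S_def T_def)
    with Suc step'[of N] show ?case by (simp add: algebra_simps)
  qed
  show ?thesis
  proof (cases N)
    case (Suc n)
    have "S n \<le> S N" by (simp add: Suc S_def)
    then have "S N \<le> 4 * M * T N" using rec[of n] by (simp add: Suc)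
    then show ?thesis by (simp add: Hardy_const_def S_def T_def M_def \<epsilon>_def)
  qed simp
qed

section \<open>Dyadic estimates towards one endpoint\<close>

text \<open>
  The points whose coordinate, with origin \<open>e\<close> and signed unit \<open>h\<close>, lies in \<open>[s, t)\<close>. Allowing a
  negative \<open>h\<close> treats both ends of an interval at once.
\<close>
definition cell :: "real \<Rightarrow> real \<Rightarrow> real \<Rightarrow> real \<Rightarrow> real set" where
  "cell e h s t = {x. s \<le> (x - e) / h \<and> (x - e) / h < t}"

lemma cell_eq:
  assumes "h \<noteq> 0"
  shows "cell e h s t = (if 0 < h then {e + h * s..<e + h * t} else {e + h * t<..e + h * s})"
  using assms by (auto simp: cell_def field_simps)

lemma disjoint_cells: "t' \<le> s \<Longrightarrow> cell e h s t \<inter> cell e h s' t' = {}"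
  by (auto simp: cell_def)

lemma is_interval_cell: "h \<noteq> 0 \<Longrightarrow> is_interval (cell e h s t)"
  by (auto simp: cell_eq is_interval_1)

lemma cell_fmeasurable: "h \<noteq> 0 \<Longrightarrow> cell e h s t \<in> fmeasurable lebesgue"
  by (cases "s \<le> t") (auto simp: cell_eq fmeasurable_def emeasure_lborel_Ico emeasure_lborel_Ioc)

lemma measure_cell:
  assumes "h \<noteq> 0" "s \<le> t"
  shows "measure lebesgue (cell e h s t) = \<bar>h\<bar> * (t - s)"
  using assms by (auto simp: cell_eq algebra_simps mult_left_mono mult_left_mono_neg)

text \<open>
  The interval has ends \<open>e\<close> and \<open>e + h\<close>, which need not belong to it. The assumption
  \<open>nested\<close> is all that is used of monotonicity, and it holds for increasing and decreasing
  functions and for both signs of \<open>h\<close>.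
\<close>
locale monotone_side =
  fixes I :: "real set" and f :: "real \<Rightarrow> real" and e h :: real
  assumes h: "h \<noteq> 0"
    and in_I: "\<And>t. 0 < t \<Longrightarrow> t < 1 \<Longrightarrow> e + h * t \<in> I"
    and int: "set_integrable lebesgue I f"
    and nested: "\<And>s u v t. 0 < s \<Longrightarrow> s \<le> u \<Longrightarrow> u \<le> v \<Longrightarrow> v \<le> t \<Longrightarrow> t < 1 \<Longrightarrow>
      \<bar>f (e + h * u) - f (e + h * v)\<bar> \<le> \<bar>f (e + h * s) - f (e + h * t)\<bar>"
begin

lemma cell_coordinate:
  assumes "x \<in> cell e h s t"
  obtains r where "x = e + h * r" "s \<le> r" "r < t"
  using assms h by (intro that[of "(x - e) / h"]) (auto simp: cell_def)

lemma cell_subset: "0 < s \<Longrightarrow> t \<le> 1 \<Longrightarrow> cell e h s t \<subseteq> I"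
  by (auto elim!: cell_coordinate intro!: in_I)

text \<open>
  The parts of the cell before \<open>u\<close> and after \<open>v\<close> carry values of \<open>f\<close> that differ by at least
  the jump from \<open>u\<close> to \<open>v\<close>, so on one of these parts \<open>f\<close> is everywhere at least half a jump
  away from its average.
\<close>
lemma jump_le_mean_osc:
  assumes "0 < s" "s \<le> u" "u \<le> v" "v \<le> t" "t \<le> 1" "s < t"
    and \<delta>: "0 \<le> \<delta>" "\<delta> \<le> u - s" "\<delta> \<le> t - v"
  shows "\<bar>f (e + h * u) - f (e + h * v)\<bar> / 2 * (\<bar>h\<bar> * \<delta>)
    \<le> measure lebesgue (cell e h s t) * mean_osc f (cell e h s t)"
proof -
  let ?J = "cell e h s t" and ?r = "\<bar>f (e + h * u) - f (e + h * v)\<bar> / 2"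
  have J: "0 < measure lebesgue ?J" using h assms by (simp add: measure_cell)
  have intJ: "set_integrable lebesgue ?J f"
    using int cell_fmeasurable[OF h] cell_subset[of s t] assms
    by (intro set_integrable_subset[OF int]) auto
  have far: "2 * ?r \<le> \<bar>f x - f y\<bar>" if "x \<in> cell e h s u" "y \<in> cell e h v t" for x y
    using that assms nested by (auto elim!: cell_coordinate)
  have bound: "?r * (\<bar>h\<bar> * \<delta>) \<le> measure lebesgue ?J * mean_osc f ?J"
    if "s \<le> a" "a \<le> b" "b \<le> t" "\<delta> \<le> b - a"
      "\<forall>x\<in>cell e h a b. ?r \<le> \<bar>f x - average f ?J\<bar>" for a b
  proof -
    have "?r * (\<bar>h\<bar> * \<delta>) \<le> ?r * measure lebesgue (cell e h a b)"
      using that h by (intro mult_left_mono) (auto simp: measure_cell)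
    also have "\<dots> \<le> measure lebesgue ?J * mean_osc f ?J"
      using that intJ J h cell_fmeasurable[OF h]
      by (intro mean_osc_ge) (auto simp: cell_def)
    finally show ?thesis .
  qed
  show ?thesis
  proof (cases "\<forall>x\<in>cell e h s u. ?r \<le> \<bar>f x - average f ?J\<bar>")
    case True
    then show ?thesis using assms by (intro bound[of s u]) auto
  next
    case False
    then obtain x where x: "x \<in> cell e h s u" "\<bar>f x - average f ?J\<bar> < ?r" by force
    have "?r \<le> \<bar>f y - average f ?J\<bar>" if "y \<in> cell e h v t" for y
      using far[OF x(1) that] x(2) by linarith
    then show ?thesis using assms by (intro bound[of v t]) auto
  qed
qed

text \<open>
  The value at the midpoint lies between the values on either side of it, so if on both sides some
  value is closer to the average than the midpoint value, the midpoint value is too: a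
  contradiction. The constant 4 comes from using a quarter of the interval on each side.
\<close>
lemma midpoint_le_mean_osc:
  assumes I: "I \<in> fmeasurable lebesgue" "0 < measure lebesgue I"
    and len: "measure lebesgue I = \<bar>h\<bar>"
  shows "\<bar>f (e + h * (1/2)) - average f I\<bar> \<le> 4 * mean_osc f I"
proof -
  let ?m = "f (e + h * (1/2))"
  let ?r = "\<bar>?m - average f I\<bar>"
  have bound: "?r \<le> 4 * mean_osc f I"
    if "0 < a" "b = a + 1/4" "b < 1" "\<forall>x\<in>cell e h a b. ?r \<le> \<bar>f x - average f I\<bar>" for a b
  proof -
    have "?r * measure lebesgue (cell e h a b) \<le> measure lebesgue I * mean_osc f I"
      using that int I cell_fmeasurable[OF h] cell_subset[of a b]
      by (intro mean_osc_ge) auto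
    then have "\<bar>h\<bar> * ?r \<le> \<bar>h\<bar> * (4 * mean_osc f I)"
      using that h by (simp add: measure_cell len)
    then show ?thesis using h by (simp add: mult_le_cancel_left)
  qed
  show ?thesis
  proof (cases "\<forall>x\<in>cell e h (1/4) (1/2). ?r \<le> \<bar>f x - average f I\<bar>")
    case True
    then show ?thesis by (intro bound[of "1/4" "1/2"]) auto
  next
    case False
    then obtain x where x: "x \<in> cell e h (1/4) (1/2)" "\<bar>f x - average f I\<bar> < ?r" by force
    have "?r \<le> \<bar>f y - average f I\<bar>" if y: "y \<in> cell e h (1/2) (3/4)" for y
    proof -
      obtain s t where st: "x = e + h * s" "1/4 \<le> s" "s < 1/2" "y = e + h * t" "1/2 \<le> t" "t < 3/4"
        using x(1) y by (meson cell_coordinate)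
      have "\<bar>f x - ?m\<bar> \<le> \<bar>f x - f y\<bar>" "\<bar>?m - f y\<bar> \<le> \<bar>f x - f y\<bar>"
        unfolding st(1) st(4) using st by (intro nested; simp)+
      then show ?thesis using x(2) by linarith
    qed
    then show ?thesis by (intro bound[of "1/2" "3/4"]) auto
  qed
qed

definition dyadic_jump :: "nat \<Rightarrow> real" where
  "dyadic_jump k = \<bar>f (e + h * (1/2) ^ (k+1)) - f (e + h * (1/2) ^ (k+2))\<bar>"

text \<open>
  The interval on which \<open>dyadic_jump k\<close> takes place, between the coordinates \<open>(1/2)^(k+2)\<close> and
  \<open>(1/2)^(k+1)\<close>, enlarged by its two neighbours.
\<close>
definition dyadic_cell :: "nat \<Rightarrow> real set" where
  "dyadic_cell k = cell e h ((1/2) ^ (k+3)) ((1/2) ^ k)"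

text \<open>
  The cell has length \<open>7/8 * \<bar>h\<bar> * (1/2)^k\<close> and its shorter outer part has \<open>1/7\<close> of that, which
  with the loss of one half in \<open>jump_le_mean_osc\<close> gives the factor 14.
\<close>
lemma dyadic_jump_energy:
  assumes "0 < p"
  shows "\<bar>h\<bar> / 4 * ((1/2) ^ k * dyadic_jump k powr p)
    \<le> 14 powr p * (measure lebesgue (dyadic_cell k) * mean_osc f (dyadic_cell k) powr p)"
proof -
  let ?q = "(1/2::real) ^ k"
  have q: "0 < ?q" "?q \<le> 1" by (simp_all add: power_le_one)
  have qs: "(1/2::real) ^ (k+1) = ?q / 2" "(1/2::real) ^ (k+2) = ?q / 4" "(1/2::real) ^ (k+3) = ?q / 8"
    by (simp_all add: power_add power2_eq_square power3_eq_cube)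
  have m: "measure lebesgue (dyadic_cell k) = \<bar>h\<bar> * ?q * (7/8)"
    using h q unfolding dyadic_cell_def qs
    by (subst measure_cell) auto
  have "dyadic_jump k / 2 * (\<bar>h\<bar> * (?q / 8))
      \<le> measure lebesgue (dyadic_cell k) * mean_osc f (dyadic_cell k)"
    using jump_le_mean_osc[of "?q / 8" "?q / 4" "?q / 2" ?q "?q / 8"] q
    unfolding dyadic_cell_def dyadic_jump_def qs by (simp add: abs_minus_commute)
  then have "\<bar>h\<bar> * ?q * dyadic_jump k \<le> \<bar>h\<bar> * ?q * (14 * mean_osc f (dyadic_cell k))"
    unfolding m by (simp add: algebra_simps)
  then have "dyadic_jump k \<le> 14 * mean_osc f (dyadic_cell k)"
    using h q by (simp add: mult_le_cancel_left)
  then have "dyadic_jump k powr p \<le> (14 * mean_osc f (dyadic_cell k)) powr p"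
    using assms by (intro powr_mono2) (auto simp: dyadic_jump_def)
  then have *: "dyadic_jump k powr p \<le> 14 powr p * mean_osc f (dyadic_cell k) powr p"
    by (simp add: powr_mult mean_osc_nonneg)
  have "\<bar>h\<bar> * ?q / 4 * dyadic_jump k powr p
      \<le> \<bar>h\<bar> * ?q * (7/8) * (14 powr p * mean_osc f (dyadic_cell k) powr p)"
    using q by (intro mult_mono *) auto
  then show ?thesis by (simp add: m algebra_simps)
qed

text \<open>
  Two dyadic cells can meet only if their indices differ by less than 3, so each residue class
  modulo 3 is a family admitted in the JN supremum.
\<close>
lemma sum_dyadic_cells_le:
  "(\<Sum>k<N. ennreal (measure lebesgue (dyadic_cell k) * mean_osc f (dyadic_cell k) powr p))
    \<le> 3 * JN_energy p I f"
proof -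
  let ?E = "\<lambda>k. ennreal (measure lebesgue (dyadic_cell k) * mean_osc f (dyadic_cell k) powr p)"
  have "(\<Sum>k<N. ?E k) = (\<Sum>i<3. \<Sum>k\<in>{k\<in>{..<N}. k mod 3 = i}. ?E k)"
    by (rule sum.group[symmetric]) auto
  also have "\<dots> \<le> (\<Sum>i<(3::nat). JN_energy p I f)"
  proof (intro sum_mono sum_le_JN_energy)
    fix i
    have sep: "dyadic_cell j \<inter> dyadic_cell k = {}" if "j mod 3 = k mod 3" "j < k" for j k :: nat
    proof -
      have "j + 3 \<le> k" using that by presburger
      then have "(1/2::real) ^ k \<le> (1/2) ^ (j+3)" by (intro power_decreasing) auto
      then show ?thesis unfolding dyadic_cell_def using disjoint_cells by blast
    qed
    show "disjoint_family_on dyadic_cell {k \<in> {..<N}. k mod 3 = i}"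
      unfolding disjoint_family_on_def
    proof (intro ballI impI)
      fix j k assume "j \<in> {k \<in> {..<N}. k mod 3 = i}" "k \<in> {k \<in> {..<N}. k mod 3 = i}" "j \<noteq> k"
      then show "dyadic_cell j \<inter> dyadic_cell k = {}"
        using sep[of j k] sep[of k j] by (cases "j < k") (auto simp: Int_commute)
    qed
    fix k
    have "(1/2::real) ^ (k+3) < (1/2) ^ k" by (intro power_strict_decreasing) auto
    then show "is_interval (dyadic_cell k) \<and> dyadic_cell k \<subseteq> I \<and> 0 < measure lebesgue (dyadic_cell k)"
      unfolding dyadic_cell_def using h
      by (intro conjI is_interval_cell cell_subset) (auto simp: measure_cell power_le_one)
  qed auto
  finally show ?thesis by simp
qed

text \<open>
  On the half of the interval next to \<open>e\<close>, the deviation from the midpoint value is dominated by a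
  step function, with the value \<open>D k\<close> on the \<open>k\<close>-th dyadic piece; Hardy's inequality replaces its
  values by the jumps. The end \<open>e\<close>, which lies in no dyadic piece, is left out.
\<close>
lemma half_deviation_le_JN_energy:
  assumes "0 < p"
  shows "(\<integral>\<^sup>+x\<in>cell e h 0 (1/2) - {e}. ennreal (\<bar>f x - f (e + h * (1/2))\<bar> powr p) \<partial>lebesgue)
    \<le> ennreal (3 * Hardy_const p * 14 powr p) * JN_energy p I f"
proof -
  define D where "D k = \<bar>f (e + h * (1/2) ^ (k+2)) - f (e + h * (1/2))\<bar>" for k
  let ?J = "\<lambda>k. cell e h ((1/2) ^ (k+2)) ((1/2) ^ (k+1))"
  let ?E = "\<lambda>k. measure lebesgue (dyadic_cell k) * mean_osc f (dyadic_cell k) powr p"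
  have H: "4 \<le> Hardy_const p" using assms by (rule Hardy_const_ge)
  have mJ: "emeasure lebesgue (?J k) = ennreal (\<bar>h\<bar> / 4 * (1/2) ^ k)" for k
  proof -
    have "emeasure lebesgue (?J k) = ennreal (measure lebesgue (?J k))"
      using fmeasurableD2[OF cell_fmeasurable[OF h]] by (intro emeasure_eq_ennreal_measure) auto
    also have "measure lebesgue (?J k) = \<bar>h\<bar> / 4 * (1/2) ^ k"
      using h by (subst measure_cell) (auto simp: power_decreasing power_add)
    finally show ?thesis .
  qed
  have pointwise: "ennreal (\<bar>f x - f (e + h * (1/2))\<bar> powr p) * indicator (cell e h 0 (1/2) - {e}) x
      \<le> (\<Sum>k. ennreal (D k powr p) * indicator (?J k) x)" for x
  proof (cases "x \<in> cell e h 0 (1/2) - {e}")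
    case True
    then have "x \<in> cell e h 0 (1/2)" "x \<noteq> e" by auto
    then obtain r where r': "x = e + h * r" "0 \<le> r" "r < 1/2" by (elim cell_coordinate)
    then have r: "x = e + h * r" "0 < r" "r < 1/2" using \<open>x \<noteq> e\<close> by (cases "r = 0"; simp)+
    \<comment> \<open>The least such \<open>n\<close> identifies the dyadic piece of \<open>x\<close>; since \<open>r < 1/2\<close>, it is at least 2.\<close>
    define n where "n = (LEAST n. (1/2) ^ n \<le> r)"
    have ex: "\<exists>n. (1/2) ^ n \<le> r" using real_arch_pow_inv[of r "1/2"] r by (auto intro: less_imp_le)
    have n: "(1/2) ^ n \<le> r" unfolding n_def using ex by (rule LeastI_ex)
    have "n \<noteq> 0" using n r by (cases "n = 0") auto
    moreover have "n \<noteq> 1" using n r by (cases "n = 1") auto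
    ultimately have "n = (n - 2) + 2" by simp
    then obtain k where k: "n = k + 2" ..
    have "\<not> (1/2) ^ (k+1) \<le> r" using not_less_Least[of "k+1" "\<lambda>n. (1/2) ^ n \<le> r"] k
      by (simp add: n_def)
    then have xk: "x \<in> ?J k" using n k r h by (simp add: cell_def)
    have "\<bar>f x - f (e + h * (1/2))\<bar> \<le> D k"
      unfolding D_def r(1) using n k r by (intro nested) auto
    then have "ennreal (\<bar>f x - f (e + h * (1/2))\<bar> powr p) \<le> ennreal (D k powr p) * indicator (?J k) x"
      using xk assms by (simp add: powr_mono2 ennreal_leI)
    also have "\<dots> \<le> (\<Sum>k. ennreal (D k powr p) * indicator (?J k) x)"
    proof -
      have "g k \<le> (\<Sum>k. g k)" for g :: "nat \<Rightarrow> ennreal"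
        using sum_le_suminf[OF summableI, of "{k}" g] by simp
      then show ?thesis .
    qed
    finally show ?thesis using True by simp
  qed simp
  have partial: "(\<Sum>k<N. ennreal (D k powr p) * emeasure lebesgue (?J k))
      \<le> ennreal (3 * Hardy_const p * 14 powr p) * JN_energy p I f" for N
  proof -
    have "(\<Sum>k<N. ennreal (D k powr p) * emeasure lebesgue (?J k))
        = ennreal (\<bar>h\<bar> / 4 * (\<Sum>k<N. (1/2) ^ k * D k powr p))"
    proof -
      have "ennreal (D k powr p) * emeasure lebesgue (?J k)
          = ennreal (\<bar>h\<bar> / 4 * ((1/2) ^ k * D k powr p))" for k
        unfolding mJ by (subst ennreal_mult'[symmetric]) (simp_all add: mult_ac)
      then show ?thesis by (simp add: sum_distrib_left)
    qed
    also have "\<dots> \<le> ennreal (\<bar>h\<bar> / 4 * (Hardy_const p * (\<Sum>k<N. (1/2) ^ k * dyadic_jump k powr p)))"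
    proof (intro ennreal_leI mult_left_mono dyadic_Hardy[OF assms])
      fix k
      show "D (Suc k) \<le> D k + dyadic_jump (Suc k)"
        by (simp add: D_def dyadic_jump_def)
    qed (auto simp: D_def dyadic_jump_def power2_eq_square)
    also have "\<dots> = ennreal (Hardy_const p * (\<Sum>k<N. \<bar>h\<bar> / 4 * ((1/2) ^ k * dyadic_jump k powr p)))"
      by (simp add: sum_distrib_left mult_ac)
    also have "\<dots> \<le> ennreal (Hardy_const p * (\<Sum>k<N. 14 powr p * ?E k))"
      using H dyadic_jump_energy[OF assms]
      by (intro ennreal_leI mult_left_mono sum_mono) auto
    also have "\<dots> = ennreal (Hardy_const p * 14 powr p) * (\<Sum>k<N. ennreal (?E k))"
    proof -
      have E: "(\<Sum>k<N. ennreal (?E k)) = ennreal (\<Sum>k<N. ?E k)" by (rule sum_ennreal) simp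
      show ?thesis
        unfolding E sum_distrib_left[symmetric] using H by (simp add: ennreal_mult' mult.assoc)
    qed
    also have "\<dots> \<le> ennreal (Hardy_const p * 14 powr p) * (3 * JN_energy p I f)"
      by (intro mult_left_mono sum_dyadic_cells_le) auto
    also have "\<dots> = ennreal (3 * Hardy_const p * 14 powr p) * JN_energy p I f"
      using H by (simp add: ennreal_mult mult_ac)
    finally show ?thesis .
  qed
  have "(\<integral>\<^sup>+x\<in>cell e h 0 (1/2) - {e}. ennreal (\<bar>f x - f (e + h * (1/2))\<bar> powr p) \<partial>lebesgue)
      \<le> (\<integral>\<^sup>+x. (\<Sum>k. ennreal (D k powr p) * indicator (?J k) x) \<partial>lebesgue)"
    by (intro nn_integral_mono pointwise)
  also have "\<dots> = (\<Sum>k. ennreal (D k powr p) * emeasure lebesgue (?J k))"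
    using cell_fmeasurable[OF h] by (subst nn_integral_suminf) (auto simp: nn_integral_cmult_indicator)
  also have "\<dots> \<le> ennreal (3 * Hardy_const p * 14 powr p) * JN_energy p I f"
    by (intro suminf_le_const partial) auto
  finally show ?thesis .
qed

end

section \<open>Deviation from the average\<close>

lemma monotone_side_of_monotone:
  assumes "h \<noteq> 0" and in_I: "\<And>t. 0 < t \<Longrightarrow> t < 1 \<Longrightarrow> e + h * t \<in> I"
    and "set_integrable lebesgue I f" and f: "mono_on I f \<or> antimono_on I f"
  shows "monotone_side I f e h"
proof
  fix s u v t :: real
  assume *: "0 < s" "s \<le> u" "u \<le> v" "v \<le> t" "t < 1"
  have dir: "(\<forall>x\<in>I. \<forall>y\<in>I. x \<le> y \<longrightarrow> f x \<le> f y) \<or> (\<forall>x\<in>I. \<forall>y\<in>I. x \<le> y \<longrightarrow> f y \<le> f x)"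
    using f by (simp add: monotone_on_def)
  have I: "e + h * s \<in> I" "e + h * u \<in> I" "e + h * v \<in> I" "e + h * t \<in> I"
    using * by (auto intro!: in_I)
  consider "e + h * s \<le> e + h * u" "e + h * u \<le> e + h * v" "e + h * v \<le> e + h * t"
    | "e + h * s \<ge> e + h * u" "e + h * u \<ge> e + h * v" "e + h * v \<ge> e + h * t"
    using * by (cases "0 \<le> h") (auto simp: mult_left_mono mult_left_mono_neg)
  then have "(f (e + h * s) \<le> f (e + h * u) \<and> f (e + h * u) \<le> f (e + h * v) \<and> f (e + h * v) \<le> f (e + h * t))
    \<or> (f (e + h * s) \<ge> f (e + h * u) \<and> f (e + h * u) \<ge> f (e + h * v) \<and> f (e + h * v) \<ge> f (e + h * t))"
    using dir I by cases blast+
  then show "\<bar>f (e + h * u) - f (e + h * v)\<bar> \<le> \<bar>f (e + h * s) - f (e + h * t)\<bar>"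
    by linarith
qed (use assms in auto)

lemma bounded_interval_endpoints:
  fixes I :: "real set"
  assumes "is_interval I" "bounded I" "0 < measure lebesgue I"
  obtains a b where "a < b" "{a<..<b} \<subseteq> I" "I \<subseteq> {a..b}"
    "I \<in> fmeasurable lebesgue" "measure lebesgue I = b - a"
proof -
  have ne: "I \<noteq> {}" and bdd: "bdd_below I" "bdd_above I"
    using assms by (auto simp: bounded_imp_bdd_below bounded_imp_bdd_above)
  have m: "I \<in> fmeasurable lebesgue"
    using assms by (intro measurable_convex) (auto simp: is_interval_convex)
  have sub: "I \<subseteq> {Inf I..Sup I}" using bdd by (auto intro: cInf_lower cSup_upper)
  have "measure lebesgue I \<le> measure lebesgue {Inf I..Sup I}"
    using sub m by (intro measure_mono_fmeasurable) auto
  also have "\<dots> = max 0 (Sup I - Inf I)" by (auto simp: max_def measure_def)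
  finally have up: "measure lebesgue I \<le> max 0 (Sup I - Inf I)" .
  with assms(3) have lt: "Inf I < Sup I" by auto
  have inner: "{Inf I<..<Sup I} \<subseteq> I"
  proof
    fix x assume "x \<in> {Inf I<..<Sup I}"
    then obtain y z where "y \<in> I" "y < x" "z \<in> I" "x < z"
      using ne bdd by (auto simp: cInf_less_iff less_cSup_iff)
    then show "x \<in> I" using assms(1) by (meson is_interval_1 less_imp_le)
  qed
  then have "measure lebesgue {Inf I<..<Sup I} \<le> measure lebesgue I"
    using m by (intro measure_mono_fmeasurable) auto
  then show thesis using up lt inner sub m by (intro that[of "Inf I" "Sup I"]) auto
qed

text \<open>
  The two halves each contribute the bound for the deviation from the midpoint value, and the
  distance from that value to the average contributes a multiple of the energy of the family that
  consists of the whole interval only.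
\<close>
lemma power_deviation_le_JN_energy:
  assumes p: "0 < p" and I: "is_interval I" "bounded I" "0 < measure lebesgue I"
    and f: "mono_on I f \<or> antimono_on I f" and int: "set_integrable lebesgue I f"
  shows "(\<integral>\<^sup>+x\<in>I. ennreal (\<bar>f x - average f I\<bar> powr p) \<partial>lebesgue)
    \<le> ennreal (2 powr p * (6 * Hardy_const p * 14 powr p + 4 powr p)) * JN_energy p I f"
proof -
  obtain a b where ab: "a < b" "{a<..<b} \<subseteq> I" "I \<subseteq> {a..b}"
    and Im: "I \<in> fmeasurable lebesgue" and mI: "measure lebesgue I = b - a"
    using bounded_interval_endpoints[OF I] .
  interpret L: monotone_side I f a "b - a"
  proof (rule monotone_side_of_monotone)
    fix t :: real assume "0 < t" "t < 1"
    then have "0 < (b - a) * t" "(b - a) * t < b - a"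
      using ab mult_strict_left_mono[of t 1 "b - a"] by simp_all
    then show "a + (b - a) * t \<in> I" using ab by (intro subsetD[OF ab(2)]) (simp add: algebra_simps)
  qed (use ab int f in auto)
  interpret R: monotone_side I f b "a - b"
  proof (rule monotone_side_of_monotone)
    fix t :: real assume "0 < t" "t < 1"
    then have "0 < (b - a) * t" "(b - a) * t < b - a"
      using ab mult_strict_left_mono[of t 1 "b - a"] by simp_all
    then show "b + (a - b) * t \<in> I" using ab
      by (intro subsetD[OF ab(2)]) (simp add: algebra_simps)
  qed (use ab int f in auto)
  define m where "m = (a + b) / 2"
  have mL: "a + (b - a) * (1/2) = m" and mR: "b + (a - b) * (1/2) = m"
    by (simp_all add: m_def field_simps)
  \<comment> \<open>The halves omit the midpoint as well as the ends; at the midpoint the deviation vanishes.\<close>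
  define HL where "HL = cell a (b - a) 0 (1/2) - {a}"
  define HR where "HR = cell b (a - b) 0 (1/2) - {b}"
  have HL: "HL = {a<..<m}" and HR: "HR = {m<..<b}"
    using ab mL mR by (auto simp: HL_def HR_def cell_eq)
  define K where "K = ennreal (3 * Hardy_const p * 14 powr p) * JN_energy p I f"
  define G where "G A = (\<integral>\<^sup>+x\<in>A. ennreal (\<bar>f x - f m\<bar> powr p) \<partial>lebesgue)" for A
  have GL: "G HL \<le> K" and GR: "G HR \<le> K"
    using L.half_deviation_le_JN_energy[OF p] R.half_deviation_le_JN_energy[OF p]
    unfolding G_def K_def HL_def HR_def mL mR by auto
  have meas: "(\<lambda>x. ennreal (\<bar>f x - f m\<bar> powr p) * indicator A x) \<in> borel_measurable lebesgue"
    if "A \<in> sets lebesgue" "A \<subseteq> I" for A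
  proof -
    have "set_integrable lebesgue A f" using int that by (rule set_integrable_subset)
    then have [measurable]: "(\<lambda>x. indicator A x * f x) \<in> borel_measurable lebesgue"
      by (simp add: set_integrable_def integrable_iff_bounded)
    note [measurable] = that(1)
    have "(\<lambda>x. ennreal (\<bar>indicator A x * f x - f m\<bar> powr p) * indicator A x) \<in> borel_measurable lebesgue"
      by measurable
    also have "(\<lambda>x. ennreal (\<bar>indicator A x * f x - f m\<bar> powr p) * indicator A x)
        = (\<lambda>x. ennreal (\<bar>f x - f m\<bar> powr p) * indicator A x)"
      by (auto simp: indicator_def)
    finally show ?thesis .
  qed
  define v where "v = \<bar>f m - average f I\<bar>"
  have "v \<le> 4 * mean_osc f I"
    using L.midpoint_le_mean_osc[OF Im I(3), unfolded mL] ab by (simp add: mI v_def)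
  then have "v powr p \<le> (4 * mean_osc f I) powr p"
    using p by (intro powr_mono2) (auto simp: v_def)
  then have v: "v powr p \<le> 4 powr p * mean_osc f I powr p"
    by (simp add: powr_mult mean_osc_nonneg)
  have single: "ennreal (measure lebesgue I * mean_osc f I powr p) \<le> JN_energy p I f"
    using sum_le_JN_energy[of "{I}" "\<lambda>J. J" I f p] I by (simp add: disjoint_family_on_def)
  have pointwise: "ennreal (\<bar>f x - average f I\<bar> powr p) * indicator I x
      \<le> ennreal (2 powr p) * (ennreal (\<bar>f x - f m\<bar> powr p) * indicator HL x
        + ennreal (\<bar>f x - f m\<bar> powr p) * indicator HR x + ennreal (v powr p) * indicator I x)"
    if "x \<noteq> a" "x \<noteq> b" for x
  proof (cases "x \<in> I")
    case True
    have "\<bar>f x - average f I\<bar> powr p \<le> (\<bar>f x - f m\<bar> + v) powr p"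
      using p by (intro powr_mono2) (auto simp: v_def)
    also have "\<dots> \<le> 2 powr p * (\<bar>f x - f m\<bar> powr p + v powr p)"
      using powr_add_le[of "\<bar>f x - f m\<bar>" v p 1] p by (simp add: v_def algebra_simps)
    finally have *: "ennreal (\<bar>f x - average f I\<bar> powr p)
        \<le> ennreal (2 powr p) * (ennreal (\<bar>f x - f m\<bar> powr p) + ennreal (v powr p))"
      by (simp add: ennreal_leI flip: ennreal_plus ennreal_mult')
    have "a < x" "x < b" using subsetD[OF ab(3) True] that by auto
    then consider "x \<in> HL" | "x \<in> HR" | "x = m"
      by (cases x m rule: linorder_cases) (auto simp: HL HR)
    then show ?thesis
    proof cases
      case 3
      then show ?thesis using * True p by (simp add: HL HR)
    qed (use * True in \<open>auto simp: HL HR\<close>)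
  qed simp
  have null: "AE x in lebesgue. x \<noteq> a \<and> x \<noteq> b"
    by (rule AE_I'[of "{a, b}"]) (auto simp: null_sets_def emeasure_lborel_countable)
  have "(\<integral>\<^sup>+x\<in>I. ennreal (\<bar>f x - average f I\<bar> powr p) \<partial>lebesgue)
      \<le> (\<integral>\<^sup>+x. ennreal (2 powr p) * (ennreal (\<bar>f x - f m\<bar> powr p) * indicator HL x
        + ennreal (\<bar>f x - f m\<bar> powr p) * indicator HR x + ennreal (v powr p) * indicator I x) \<partial>lebesgue)"
    by (rule nn_integral_mono_AE, rule eventually_mono[OF null]) (blast intro: pointwise)
  also have "\<dots> = ennreal (2 powr p) * (G HL + G HR + ennreal (v powr p) * emeasure lebesgue I)"
  proof -
    have sub: "HL \<subseteq> I" "HR \<subseteq> I"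
      using ab(1) by (auto simp: HL HR m_def intro!: subsetD[OF ab(2)])
    have [measurable]: "(\<lambda>x. ennreal (\<bar>f x - f m\<bar> powr p) * indicator HL x) \<in> borel_measurable lebesgue"
      "(\<lambda>x. ennreal (\<bar>f x - f m\<bar> powr p) * indicator HR x) \<in> borel_measurable lebesgue"
      using sub by (intro meas; simp add: HL HR)+
    have [measurable]: "I \<in> sets lebesgue" using Im by auto
    show ?thesis unfolding G_def
      by (simp add: nn_integral_cmult nn_integral_add nn_integral_cmult_indicator)
  qed
  also have "\<dots> \<le> ennreal (2 powr p) * (K + K + ennreal (4 powr p) * JN_energy p I f)"
  proof (intro mult_left_mono add_mono GL GR)
    have "ennreal (v powr p) * emeasure lebesgue I = ennreal (v powr p * measure lebesgue I)"
      using fmeasurableD2[OF Im] by (simp add: emeasure_eq_ennreal_measure ennreal_mult')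
    also have "\<dots> \<le> ennreal (4 powr p * (measure lebesgue I * mean_osc f I powr p))"
      using mult_right_mono[OF v, of "measure lebesgue I"] by (intro ennreal_leI) (simp add: mult_ac)
    also have "\<dots> \<le> ennreal (4 powr p) * JN_energy p I f"
      using mult_left_mono[OF single, of "ennreal (4 powr p)"] by (simp add: ennreal_mult')
    finally show "ennreal (v powr p) * emeasure lebesgue I \<le> ennreal (4 powr p) * JN_energy p I f" .
  qed auto
  also have "\<dots> = ennreal (2 powr p * (6 * Hardy_const p * 14 powr p + 4 powr p)) * JN_energy p I f"
  proof -
    have "K + K + ennreal (4 powr p) * JN_energy p I f
        = ennreal (6 * Hardy_const p * 14 powr p + 4 powr p) * JN_energy p I f"
      using Hardy_const_ge[OF p] unfolding K_def
      by (simp flip: distrib_right ennreal_plus)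
    then show ?thesis by (simp add: ennreal_mult' mult.assoc)
  qed
  finally show ?thesis .
qed

theorem theorem2p1:
  fixes p :: real
  assumes "1 < p"
  shows "\<exists>c::real. c > 0 \<and>
    (\<forall>(I0 :: real set) (f :: real \<Rightarrow> real).
       is_interval I0 \<longrightarrow> bounded I0 \<longrightarrow> 0 < measure lebesgue I0 \<longrightarrow>
       mono_on I0 f \<or> antimono_on I0 f \<longrightarrow>
       set_integrable lebesgue I0 f \<longrightarrow>
       JN_norm p I0 f \<ge> ennreal c * Lp_norm p I0 (\<lambda>x. f x - average f I0))"
proof -
  have p: "0 < p" using assms by simp
  define C where "C = 2 powr p * (6 * Hardy_const p * 14 powr p + 4 powr p)"
  have C: "0 < C" using Hardy_const_ge[OF p] by (auto simp: C_def intro!: mult_pos_pos add_nonneg_pos)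
  have "ennreal (C powr - (1 / p)) * Lp_norm p I0 (\<lambda>x. f x - average f I0) \<le> JN_norm p I0 f"
    if "is_interval I0" "bounded I0" "0 < measure lebesgue I0"
      "mono_on I0 f \<or> antimono_on I0 f" "set_integrable lebesgue I0 f" for I0 f
    using ennreal_powr_scaled_le[OF power_deviation_le_JN_energy[OF p that] C[unfolded C_def], of "1 / p"] p
    unfolding Lp_norm_def JN_norm_def JN_energy_def C_def by simp
  then show ?thesis using C by (intro exI[of _ "C powr - (1 / p)"]) auto
qed

end
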